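(* Let $(X,\mu)$ be a computable probability space and $n\ge 1$. If $x\in X$ is weakly $n$-random, then for any $\Sigma^0_n$ set $A\ni x$ with $\mu(A)>0$ and any computable measure-preserving transformation $T:\subseteq X\to X$ with $x\in\operatorname{dom}T$, we have $T^k(x)\in A$ for some $k>0$.
   Context: Uniformity: a sequence of objects has a property (whose definition involves an index in $\mathbb N$) uniformly if a computable function produces suitable indices. A computable metric space is a triple $(X,d,S)$ where $(X,d)$ is a complete separable metric space, $S=(s_i)_i$ is a dense sequence in $X$, and $d(s_i,s_j)$ is a computable real number uniformly in $i,j$. With $(q_j)_j$ a fixed enumeration of the positive rationals and $\langle\cdot,\cdot\rangle$ the standard pairing function, the ideal balls are $B_{\langle i,j\rangle}=\{x\in X: d(x,s_i)<q_j\}$. A set $U\subseteq X$ is $\Sigma^0_1$ if $U=\bigcup_{i\in W}B_i$ for some c.e. $W\subseteq\mathbb N$ (its index is an index of $W$). A set is $\Pi^0_n$ if its complement is $\Sigma^0_n$. A set is $\Sigma^0_{n+1}$ if it equals $\bigcup_{i\in W}(X\setminus U^n_i)$ for some c.e. $W\subseteq\mathbb N$, where $U^n_i$ is the $i$-th $\Sigma^0_n$ set. For $D\subseteq X$, a subset of $D$ is $\Sigma^0_n$ in $D$ if it is the intersection of $D$ with a $\Sigma^0_n$ subset of $X$. A computable probability space $(X,\mu)$ is a computable metric space with a Borel probability measure $\mu$ such that $\mu(\bigcup_{i\in F}B_i)$ is lower-semicomputable uniformly in finite $F\subseteq\mathbb N$. A point is weakly $n$-random if it lies in no $\mu$-null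 $\Pi^0_n$ set. A measure-preserving transformation is a partial Borel measurable map $T:\subseteq X\to X$ such that $\mu(T^{-1}(B))=\mu(B)$ for every Borel $B$ (so $\operatorname{dom}T$ has full measure) and $x\in\operatorname{dom}T$ implies $T(x)\in\operatorname{dom}T$. It is computable if the sets $T^{-1}(B_i)$ are uniformly $\Sigma^0_1$ in $\operatorname{dom}T$. *)

theory Defs
  imports "HOL-Probability.Probability_Measure" "HOL-Library.Nat_Bijection"
begin

section \<open>Partial recursive functions and c.e. sets\<close>

text \<open>
  Programs for the unary partial recursive functions; tuples are passed through the Cantor
  pairing function \<^const>\<open>prod_encode\<close>.
\<close>

datatype prog =
    PZero
  | PSucc
  | PFst
  | PSnd
  | PPair prog prog
  | PComp prog prog
  | PRec prog prog
  | PMin prog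

inductive runs :: "prog \<Rightarrow> nat \<Rightarrow> nat \<Rightarrow> bool" where
  runs_zero: "runs PZero x 0"
| runs_succ: "runs PSucc x (Suc x)"
| runs_fst: "runs PFst (prod_encode (x, y)) x"
| runs_snd: "runs PSnd (prod_encode (x, y)) y"
| runs_pair: "runs f x y \<Longrightarrow> runs g x z \<Longrightarrow> runs (PPair f g) x (prod_encode (y, z))"
| runs_comp: "runs g x y \<Longrightarrow> runs f y z \<Longrightarrow> runs (PComp f g) x z"
| runs_rec_0: "runs f a y \<Longrightarrow> runs (PRec f g) (prod_encode (a, 0)) y"
| runs_rec_Suc:
    "runs (PRec f g) (prod_encode (a, n)) y \<Longrightarrow>
     runs g (prod_encode (a, prod_encode (n, y))) z \<Longrightarrow>
     runs (PRec f g) (prod_encode (a, Suc n)) z"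
| runs_min:
    "runs f (prod_encode (a, n)) 0 \<Longrightarrow>
     (\<And>m. m < n \<Longrightarrow> \<exists>y. runs f (prod_encode (a, m)) (Suc y)) \<Longrightarrow>
     runs (PMin f) a n"

text \<open>A Goedel numbering; it is a bijection between programs and natural numbers.\<close>

primrec goedel :: "prog \<Rightarrow> nat" where
  "goedel PZero = 0"
| "goedel PSucc = 1"
| "goedel PFst = 2"
| "goedel PSnd = 3"
| "goedel (PPair f g) = 4 + 4 * prod_encode (goedel f, goedel g)"
| "goedel (PComp f g) = 5 + 4 * prod_encode (goedel f, goedel g)"
| "goedel (PRec f g) = 6 + 4 * prod_encode (goedel f, goedel g)"
| "goedel (PMin f) = 7 + 4 * goedel f"

definition phi :: "nat \<Rightarrow> nat \<Rightarrow> nat \<Rightarrow> bool" where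
  "phi e x y \<longleftrightarrow> (\<exists>p. goedel p = e \<and> runs p x y)"

definition ce_set :: "nat \<Rightarrow> nat set" where
  "ce_set e = {x. \<exists>y. phi e x y}"

definition computable_fun :: "(nat \<Rightarrow> nat) \<Rightarrow> bool" where
  "computable_fun f \<longleftrightarrow> (\<exists>e. \<forall>x. phi e x (f x))"

text \<open>
  A property whose definition involves an index is given as a relation between indices and
  objects.
\<close>

definition uniformly :: "(nat \<Rightarrow> 'b \<Rightarrow> bool) \<Rightarrow> (nat \<Rightarrow> 'b) \<Rightarrow> bool" where
  "uniformly P X \<longleftrightarrow> (\<exists>f. computable_fun f \<and> (\<forall>i. P (f i) (X i)))"


section \<open>Computable and lower-semicomputable reals\<close>

text \<open>Effective enumerations (with repetitions) of all rationals and of the positive rationals.\<close>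

definition rat_enum :: "nat \<Rightarrow> real" where
  "rat_enum n = (case prod_decode n of (a, m) \<Rightarrow> case prod_decode m of (b, c) \<Rightarrow>
     (real a - real b) / (real c + 1))"

definition pos_rat_enum :: "nat \<Rightarrow> real" where
  "pos_rat_enum n = (case prod_decode n of (a, b) \<Rightarrow> (real a + 1) / (real b + 1))"

definition computable_real_index :: "nat \<Rightarrow> real \<Rightarrow> bool" where
  "computable_real_index e r \<longleftrightarrow> (\<forall>k. \<exists>n. phi e k n \<and> \<bar>rat_enum n - r\<bar> \<le> 1 / 2 ^ k)"

definition lower_semicomputable_index :: "nat \<Rightarrow> real \<Rightarrow> bool" where
  "lower_semicomputable_index e r \<longleftrightarrow> ce_set e = {n. rat_enum n < r}"


section \<open>Computable metric spaces and the effective Borel hierarchy\<close>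

text \<open>
  The complete separable metric space is a type of class \<^class>\<open>polish_space\<close>
  with its metric \<^const>\<open>dist\<close>.
\<close>

definition computable_metric_space :: "(nat \<Rightarrow> 'a::polish_space) \<Rightarrow> bool" where
  "computable_metric_space s \<longleftrightarrow>
     closure (range s) = UNIV \<and>
     uniformly computable_real_index
       (\<lambda>m. case prod_decode m of (i, j) \<Rightarrow> dist (s i) (s j))"

definition ideal_ball :: "(nat \<Rightarrow> 'a::polish_space) \<Rightarrow> nat \<Rightarrow> 'a set" where
  "ideal_ball s m = (case prod_decode m of (i, j) \<Rightarrow> ball (s i) (pos_rat_enum j))"

text \<open>
  \<open>Sigma_set s n e\<close> is the \<open>e\<close>-th \<open>\<Sigma>\<^sup>0\<^sub>n\<close> set, for \<open>n \<ge> 1\<close>.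
  The hierarchy starts at level 1; the value at level 0 is a dummy.
\<close>

fun Sigma_set :: "(nat \<Rightarrow> 'a::polish_space) \<Rightarrow> nat \<Rightarrow> nat \<Rightarrow> 'a set" where
  "Sigma_set s 0 e = {}"
| "Sigma_set s (Suc 0) e = (\<Union>i\<in>ce_set e. ideal_ball s i)"
| "Sigma_set s (Suc (Suc n)) e = (\<Union>i\<in>ce_set e. - Sigma_set s (Suc n) i)"

definition is_Sigma :: "(nat \<Rightarrow> 'a::polish_space) \<Rightarrow> nat \<Rightarrow> 'a set \<Rightarrow> bool" where
  "is_Sigma s n A \<longleftrightarrow> (\<exists>e. A = Sigma_set s n e)"

definition is_Pi :: "(nat \<Rightarrow> 'a::polish_space) \<Rightarrow> nat \<Rightarrow> 'a set \<Rightarrow> bool" where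
  "is_Pi s n A \<longleftrightarrow> is_Sigma s n (- A)"

definition Sigma_in_index ::
    "(nat \<Rightarrow> 'a::polish_space) \<Rightarrow> nat \<Rightarrow> 'a set \<Rightarrow> nat \<Rightarrow> 'a set \<Rightarrow> bool" where
  "Sigma_in_index s n D e U \<longleftrightarrow> U = D \<inter> Sigma_set s n e"


section \<open>Computable probability spaces, weak randomness, transformations\<close>

text \<open>Finite sets of natural numbers are given by their canonical (binary) index,
  see \<^const>\<open>set_decode\<close>.\<close>

definition computable_probability_space ::
    "(nat \<Rightarrow> 'a::polish_space) \<Rightarrow> 'a measure \<Rightarrow> bool" where
  "computable_probability_space s \<mu> \<longleftrightarrow>
     computable_metric_space s \<and>
     sets \<mu> = sets borel \<and> prob_space \<mu> \<and>
     uniformly lower_semicomputable_index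
       (\<lambda>u. measure \<mu> (\<Union>i\<in>set_decode u. ideal_ball s i))"

definition weakly_random ::
    "(nat \<Rightarrow> 'a::polish_space) \<Rightarrow> 'a measure \<Rightarrow> nat \<Rightarrow> 'a \<Rightarrow> bool" where
  "weakly_random s \<mu> n x \<longleftrightarrow> (\<forall>P. is_Pi s n P \<and> P \<in> null_sets \<mu> \<longrightarrow> x \<notin> P)"

definition pre_image :: "('a \<rightharpoonup> 'a) \<Rightarrow> 'a set \<Rightarrow> 'a set" where
  "pre_image T B = {x. \<exists>y\<in>B. T x = Some y}"

definition measure_preserving :: "'a measure \<Rightarrow> ('a \<rightharpoonup> 'a) \<Rightarrow> bool" where
  "measure_preserving \<mu> T \<longleftrightarrow>
     (\<forall>B\<in>sets \<mu>. pre_image T B \<in> sets \<mu> \<and> emeasure \<mu> (pre_image T B) = emeasure \<mu> B) \<and>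
     (\<forall>x y. T x = Some y \<longrightarrow> y \<in> dom T)"

definition computable_transformation ::
    "(nat \<Rightarrow> 'a::polish_space) \<Rightarrow> ('a \<rightharpoonup> 'a) \<Rightarrow> bool" where
  "computable_transformation s T \<longleftrightarrow>
     uniformly (Sigma_in_index s 1 (dom T)) (\<lambda>i. pre_image T (ideal_ball s i))"

primrec iterate :: "('a \<rightharpoonup> 'a) \<Rightarrow> nat \<Rightarrow> ('a \<rightharpoonup> 'a)" where
  "iterate T 0 = Some"
| "iterate T (Suc k) = T \<circ>\<^sub>m iterate T k"

end

theory Submission
  imports Defs
begin

text \<open>
  A \<open>\<Sigma>\<^sup>0\<^sub>n\<close> set is also \<open>\<Sigma>\<^sup>0\<^sub>n\<^sub>+\<^sub>1\<close>, hence a union of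
  \<open>\<Pi>\<^sup>0\<^sub>n\<close> sets, so \<open>x\<close> lies in a \<open>\<Pi>\<^sup>0\<^sub>n\<close> set \<open>C \<subseteq> A\<close>. As \<open>T\<close> is computable, there are
  \<open>\<Sigma>\<^sup>0\<^sub>n\<close> sets \<open>S\<^sub>k\<close>, uniformly in \<open>k > 0\<close>, whose intersections with \<open>dom T\<close> are the
  preimages of \<open>A\<close> under \<open>T^k\<close>. So \<open>P = C - (\<Union>k. S\<^sub>k)\<close> is \<open>\<Pi>\<^sup>0\<^sub>n\<close>, and it is null by Poincare
  recurrence. Therefore \<open>x \<notin> P\<close>, which means \<open>x \<in> S\<^sub>k\<close> for some \<open>k\<close>. The uniform union over
  \<open>k\<close> rests on the graph of the universal partial recursive function being c.e.
\<close>

section \<open>Computable functions\<close>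

text \<open>The atoms take the values below 4 and the compound constructors different residues
  modulo 4 above them, so the outermost constructor can be read off the number.\<close>

lemma goedel_inject: "goedel p = goedel q \<longleftrightarrow> p = q"
proof (induction p arbitrary: q)
  case PZero then show ?case by (cases q) auto
next
  case PSucc then show ?case by (cases q) auto
next
  case PFst then show ?case by (cases q) auto
next
  case PSnd then show ?case by (cases q) auto
next
  case (PPair f g) then show ?case by (cases q; simp; presburger)
next
  case (PComp f g) then show ?case by (cases q; simp; presburger)
next
  case (PRec f g) then show ?case by (cases q; simp; presburger)
next
  case (PMin f) then show ?case by (cases q; simp; presburger)
qed

text \<open>This supplies a program for a code about which nothing is known, such as the step
  program of a recursion evaluated at 0.\<close>

lemma goedel_surj: "\<exists>p. goedel p = e"
proof (induction e rule: less_induct)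
  case (less e)
  have code: "\<exists>p q. prod_encode (goedel p, goedel q) = c" if "c < e" for c
  proof -
    obtain a b where c: "c = prod_encode (a, b)" by (metis prod.collapse prod_decode_inverse)
    then have "a < e" "b < e"
      using le_prod_encode_1[of a b] le_prod_encode_2[of b a] that by linarith+
    then show ?thesis using less c by metis
  qed
  show ?case
  proof (cases "e < 4")
    case True
    then have "e = goedel PZero \<or> e = goedel PSucc \<or> e = goedel PFst \<or> e = goedel PSnd"
      by auto
    then show ?thesis by blast
  next
    case False
    then obtain c r where e: "e = 4 + r + 4 * c" "r < 4"
      by (metis add.assoc add.commute le_add_diff_inverse mod_less_divisor mod_mult_div_eq
          not_less zero_less_numeral)
    then have "c < e" by simp
    with code obtain p q where pq: "prod_encode (goedel p, goedel q) = c" by blast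
    from less[OF \<open>c < e\<close>] obtain p' where p': "goedel p' = c" by blast
    have "e = goedel (PPair p q) \<or> e = goedel (PComp p q) \<or> e = goedel (PRec p q) \<or>
        e = goedel (PMin p')"
      unfolding goedel.simps pq p' using e by linarith
    then show ?thesis by blast
  qed
qed

lemma phi_goedel: "phi (goedel p) x y \<longleftrightarrow> runs p x y"
  by (auto simp: phi_def goedel_inject)

text \<open>For minimisation, if two results differed, the body would return both 0 and a successor
  at the smaller one.\<close>

lemma runs_deterministic: "runs p x y \<Longrightarrow> runs p x z \<Longrightarrow> y = z"
proof (induction arbitrary: z rule: runs.induct)
  case (runs_pair f x y g z')
  from runs_pair.prems show ?case
    by cases (use runs_pair.IH in auto)
next
  case (runs_comp g x y f z')
  from runs_comp.prems show ?case
    by cases (use runs_comp.IH in auto)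
next
  case (runs_rec_0 f a y g)
  from runs_rec_0.prems show ?case
    by cases (use runs_rec_0.IH in auto)
next
  case (runs_rec_Suc f g a n y z')
  from runs_rec_Suc.prems show ?case
    by cases (use runs_rec_Suc.IH in auto)
next
  case (runs_min f a n)
  from runs_min.prems show ?case
  proof cases
    case (runs_min)
    have "\<not> n < z"
      using runs_min(2) runs_min.IH(1) by (metis nat.distinct(1))
    moreover have "\<not> z < n"
      using runs_min(1) runs_min.IH(2) by (metis nat.distinct(1))
    ultimately show ?thesis by simp
  qed
qed (auto elim: runs.cases)

lemma phi_deterministic: "phi e x y \<Longrightarrow> phi e x z \<Longrightarrow> y = z"
  by (metis phi_def goedel_inject runs_deterministic)

section \<open>Closure properties of computable functions\<close>

lemma computable_fun_iff: "computable_fun f \<longleftrightarrow> (\<exists>p. \<forall>x. runs p x (f x))"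
  unfolding computable_fun_def by (metis phi_def phi_goedel)

lemma computable_comp:
  assumes "computable_fun f" "computable_fun g"
  shows "computable_fun (\<lambda>x. f (g x))"
  using assms unfolding computable_fun_iff by (metis runs_comp)

lemma computable_pair:
  assumes "computable_fun f" "computable_fun g"
  shows "computable_fun (\<lambda>x. prod_encode (f x, g x))"
  using assms unfolding computable_fun_iff by (metis runs_pair)

lemma runs_fst': "runs PFst x (fst (prod_decode x))"
  by (metis prod.collapse prod_decode_inverse runs_fst)

lemma runs_snd': "runs PSnd x (snd (prod_decode x))"
  by (metis prod.collapse prod_decode_inverse runs_snd)

lemma runs_id: "runs (PPair PFst PSnd) x x"
  by (metis prod.collapse prod_decode_inverse runs_pair runs_fst' runs_snd')

lemma computable_id: "computable_fun (\<lambda>x. x)"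
  unfolding computable_fun_iff using runs_id by blast

lemma computable_fst:
  "computable_fun f \<Longrightarrow> computable_fun (\<lambda>x. fst (prod_decode (f x)))"
  unfolding computable_fun_iff by (metis runs_comp runs_fst')

lemma computable_snd:
  "computable_fun f \<Longrightarrow> computable_fun (\<lambda>x. snd (prod_decode (f x)))"
  unfolding computable_fun_iff by (metis runs_comp runs_snd')

lemma computable_Suc: "computable_fun f \<Longrightarrow> computable_fun (\<lambda>x. Suc (f x))"
  unfolding computable_fun_iff by (metis runs_comp runs_succ)

text \<open>Constants get explicit programs, built by recursion, so that their Goedel numbers are
  computable in the constant; the s-m-n theorem hard-codes its parameter this way.\<close>

primrec const_prog :: "nat \<Rightarrow> prog" where
  "const_prog 0 = PZero"
| "const_prog (Suc n) = PComp PSucc (const_prog n)"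

lemma runs_const: "runs (const_prog n) x n"
  by (induction n) (auto intro: runs.intros)

lemma computable_const: "computable_fun (\<lambda>x. c)"
  unfolding computable_fun_iff using runs_const by blast

text \<open>The hypothesis on \<open>g\<close> follows the nested triple of parameter, counter and
  previous value that \<open>PRec\<close> passes to its step program. The parameter \<open>x\<close>
  is also the argument of the bound \<open>b\<close>.\<close>

lemma computable_rec:
  assumes f: "computable_fun f" and b: "computable_fun b"
    and g: "computable_fun (\<lambda>z. g (fst (prod_decode z)) (fst (prod_decode (snd (prod_decode z))))
                                  (snd (prod_decode (snd (prod_decode z)))))"
  shows "computable_fun (\<lambda>x. rec_nat (f x) (g x) (b x))"
proof -
  from f obtain pf where pf: "\<And>x. runs pf x (f x)" unfolding computable_fun_iff by blast
  from g obtain pg where "\<And>z. runs pg z (g (fst (prod_decode z))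
      (fst (prod_decode (snd (prod_decode z)))) (snd (prod_decode (snd (prod_decode z)))))"
    unfolding computable_fun_iff by blast
  from this[of "prod_encode (_, prod_encode (_, _))"]
  have pg: "\<And>x n y. runs pg (prod_encode (x, prod_encode (n, y))) (g x n y)" by simp
  have "runs (PRec pf pg) (prod_encode (x, n)) (rec_nat (f x) (g x) n)" for x n
    by (induction n) (auto intro: runs.intros pf pg)
  then have "computable_fun (\<lambda>z. rec_nat (f (fst (prod_decode z))) (g (fst (prod_decode z)))
      (snd (prod_decode z)))"
    unfolding computable_fun_iff by (metis prod.collapse prod_decode_inverse)
  from computable_comp[OF this computable_pair[OF computable_id b]]
  show ?thesis by simp
qed

lemmas computable_basic = computable_id computable_const computable_fst computable_snd
  computable_pair computable_Suc

section \<open>Arithmetic, bounded sums and bounded products\<close>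

lemma computable_add:
  assumes "computable_fun f" "computable_fun g"
  shows "computable_fun (\<lambda>x. f x + g x)"
proof -
  have eq: "rec_nat m (\<lambda>_ r. Suc r) n = m + n" for m n by (induction n) auto
  have "computable_fun (\<lambda>x. rec_nat (f x) (\<lambda>_ r. Suc r) (g x))"
    by (rule computable_rec) (intro assms computable_basic)+
  then show ?thesis by (simp add: eq)
qed

lemma computable_mult:
  assumes "computable_fun f" "computable_fun g"
  shows "computable_fun (\<lambda>x. f x * g x)"
proof -
  have eq: "rec_nat 0 (\<lambda>_ r. r + m) n = m * n" for m n :: nat by (induction n) auto
  have "computable_fun (\<lambda>x. rec_nat 0 (\<lambda>_ r. r + f x) (g x))"
    by (rule computable_rec)
      (intro assms computable_basic computable_add computable_comp[OF assms(1)])+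
  then show ?thesis by (simp add: eq)
qed

lemma computable_power:
  assumes "computable_fun f" "computable_fun g"
  shows "computable_fun (\<lambda>x. f x ^ g x)"
proof -
  have eq: "rec_nat (Suc 0) (\<lambda>_ r. r * m) n = m ^ n" for m n :: nat by (induction n) auto
  have "computable_fun (\<lambda>x. rec_nat (Suc 0) (\<lambda>_ r. r * f x) (g x))"
    by (rule computable_rec)
      (intro assms computable_basic computable_mult computable_comp[OF assms(1)])+
  then show ?thesis by (simp add: eq)
qed

lemma computable_diff:
  assumes "computable_fun f" "computable_fun g"
  shows "computable_fun (\<lambda>x. f x - g x)"
proof -
  \<comment> \<open>The predecessor is a recursion that returns its counter and ignores the previous
    value; truncated subtraction iterates it.\<close>
  have pred_eq: "rec_nat 0 (\<lambda>k _. k) n = n - 1" for n by (cases n) auto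
  have pred: "computable_fun (\<lambda>n. n - 1)"
    using computable_rec[of "\<lambda>_. 0" "\<lambda>n. n" "\<lambda>_ k _. k"]
    by (simp add: pred_eq computable_basic)
  have eq: "rec_nat m (\<lambda>_ r. r - 1) n = m - n" for m n :: nat by (induction n) auto
  have "computable_fun (\<lambda>x. rec_nat (f x) (\<lambda>_ r. r - 1) (g x))"
    by (rule computable_rec) (intro assms computable_basic computable_comp[OF pred])+
  then show ?thesis unfolding eq .
qed

lemma computable_sum:
  assumes f: "computable_fun (\<lambda>z. f (fst (prod_decode z)) (snd (prod_decode z)))"
    and b: "computable_fun b"
  shows "computable_fun (\<lambda>x. \<Sum>y<b x. f x y)"
proof -
  have f': "computable_fun (\<lambda>z. f (g z) (h z))" if "computable_fun g" "computable_fun h" for g h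
    using computable_comp[OF f computable_pair[OF that]] by simp
  have eq: "rec_nat 0 (\<lambda>y r. r + f x y) n = (\<Sum>y<n. f x y)" for x n by (induction n) auto
  have "computable_fun (\<lambda>x. rec_nat 0 (\<lambda>y r. r + f x y) (b x))"
    by (rule computable_rec) (intro b computable_basic computable_add f')+
  then show ?thesis by (simp add: eq)
qed

lemma computable_prod:
  assumes f: "computable_fun (\<lambda>z. f (fst (prod_decode z)) (snd (prod_decode z)))"
    and b: "computable_fun b"
  shows "computable_fun (\<lambda>x. \<Prod>y<b x. f x y)"
proof -
  have f': "computable_fun (\<lambda>z. f (g z) (h z))" if "computable_fun g" "computable_fun h" for g h
    using computable_comp[OF f computable_pair[OF that]] by simp
  have eq: "rec_nat (Suc 0) (\<lambda>y r. r * f x y) n = (\<Prod>y<n. f x y)" for x n by (induction n) auto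
  have "computable_fun (\<lambda>x. rec_nat (Suc 0) (\<lambda>y r. r * f x y) (b x))"
    by (rule computable_rec) (intro b computable_basic computable_mult f')+
  then show ?thesis by (simp add: eq)
qed

lemmas computable_intros = computable_basic computable_add computable_mult computable_power
  computable_diff


section \<open>Semidecidable predicates\<close>

text \<open>Programs are unary, so the two arguments are coded as a pair; the curried form lets
  \<open>computable_comp2\<close> match ordinary applications \<open>f (g z) (h z)\<close>.\<close>

definition computable_fun2 :: "(nat \<Rightarrow> nat \<Rightarrow> nat) \<Rightarrow> bool" where
  "computable_fun2 f \<longleftrightarrow> computable_fun (\<lambda>z. f (fst (prod_decode z)) (snd (prod_decode z)))"

lemma computable_comp2:
  assumes "computable_fun2 f" "computable_fun g" "computable_fun h"
  shows "computable_fun (\<lambda>z. f (g z) (h z))"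
  using computable_comp[OF assms(1)[unfolded computable_fun2_def] computable_pair[OF assms(2,3)]]
  by simp

text \<open>Testing for the value 0 turns conjunction into a sum and disjunction into a product, and
  it is the test that \<open>PMin\<close> searches for.\<close>

definition semidec :: "(nat \<Rightarrow> bool) \<Rightarrow> bool" where
  "semidec P \<longleftrightarrow> (\<exists>f. computable_fun2 f \<and> (\<forall>x. P x \<longleftrightarrow> (\<exists>t. f x t = 0)))"

lemma semidecI:
  assumes "computable_fun (\<lambda>z. f (fst (prod_decode z)) (snd (prod_decode z)))"
    and "\<And>x. P x \<longleftrightarrow> (\<exists>t. f x t = (0::nat))"
  shows "semidec P"
  unfolding semidec_def computable_fun2_def using assms by blast

lemma semidec_comp:
  assumes P: "semidec P" and g: "computable_fun g"
  shows "semidec (\<lambda>x. P (g x))"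
proof -
  obtain f where f: "computable_fun2 f" and P: "\<And>x. P x \<longleftrightarrow> (\<exists>t. f x t = 0)"
    using P unfolding semidec_def by blast
  show ?thesis
    by (rule semidecI[where f = "\<lambda>x t. f (g x) t"])
      (intro computable_comp2[OF f] computable_comp[OF g] computable_intros, simp add: P)
qed

lemma semidec_eq:
  assumes f: "computable_fun f" and g: "computable_fun g"
  shows "semidec (\<lambda>x. f x = g x)"
  by (rule semidecI[where f = "\<lambda>x t. (f x - g x) + (g x - f x)"])
    (intro computable_comp[OF f] computable_comp[OF g] computable_intros, auto)

text \<open>Two searches merge into one by letting a single number code both witnesses.\<close>

lemma ex_pair_iff: "(\<exists>t. R (fst (prod_decode t)) (snd (prod_decode t))) \<longleftrightarrow> (\<exists>a b. R a b)"
  by (metis prod.sel prod_encode_inverse)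

lemma semidec_conj:
  assumes "semidec P" "semidec Q"
  shows "semidec (\<lambda>x. P x \<and> Q x)"
proof -
  obtain f where f: "computable_fun2 f"
    and P: "\<And>x. P x \<longleftrightarrow> (\<exists>t. f x t = 0)"
    using assms(1) unfolding semidec_def by blast
  obtain f' where f': "computable_fun2 f'"
    and Q: "\<And>x. Q x \<longleftrightarrow> (\<exists>t. f' x t = 0)"
    using assms(2) unfolding semidec_def by blast
  show ?thesis
    by (rule semidecI[where f = "\<lambda>x t. f x (fst (prod_decode t)) + f' x (snd (prod_decode t))"])
      (intro computable_comp2[OF f] computable_comp2[OF f'] computable_intros,
        use ex_pair_iff[of "\<lambda>a b. f _ a + f' _ b = 0"] in \<open>simp add: P Q\<close>)
qed

lemma semidec_disj:
  assumes "semidec P" "semidec Q"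
  shows "semidec (\<lambda>x. P x \<or> Q x)"
proof -
  obtain f where f: "computable_fun2 f"
    and P: "\<And>x. P x \<longleftrightarrow> (\<exists>t. f x t = 0)"
    using assms(1) unfolding semidec_def by blast
  obtain f' where f': "computable_fun2 f'"
    and Q: "\<And>x. Q x \<longleftrightarrow> (\<exists>t. f' x t = 0)"
    using assms(2) unfolding semidec_def by blast
  show ?thesis
    by (rule semidecI[where f = "\<lambda>x t. f x t * f' x t"])
      (intro computable_comp2[OF f] computable_comp2[OF f'] computable_intros, auto simp: P Q)
qed

lemma semidec_ex:
  assumes "semidec (\<lambda>z. P (fst (prod_decode z)) (snd (prod_decode z)))"
  shows "semidec (\<lambda>x. \<exists>y. P x y)"
proof -
  obtain f where f: "computable_fun2 f"
    and "\<And>z. P (fst (prod_decode z)) (snd (prod_decode z)) \<longleftrightarrow> (\<exists>t. f z t = 0)"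
    using assms unfolding semidec_def by blast
  from this(2)[of "prod_encode (_, _)"]
  have P: "\<And>x y. P x y \<longleftrightarrow> (\<exists>t. f (prod_encode (x, y)) t = 0)" by simp
  show ?thesis
    by (rule semidecI[where f = "\<lambda>x t. f (prod_encode (x, fst (prod_decode t))) (snd (prod_decode t))"])
      (intro computable_comp2[OF f] computable_intros,
        use ex_pair_iff[of "\<lambda>a b. f (prod_encode (_, a)) b = 0"] in \<open>simp add: P\<close>)
qed

lemma semidec_ball:
  assumes "semidec (\<lambda>z. P (fst (prod_decode z)) (snd (prod_decode z)))" and b: "computable_fun b"
  shows "semidec (\<lambda>x. \<forall>y<b x. P x y)"
proof -
  obtain f where f: "computable_fun2 f"
    and "\<And>z. P (fst (prod_decode z)) (snd (prod_decode z)) \<longleftrightarrow> (\<exists>t. f z t = 0)"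
    using assms(1) unfolding semidec_def by blast
  from this(2)[of "prod_encode (_, _)"]
  have P: "\<And>x y. P x y \<longleftrightarrow> (\<exists>t. f (prod_encode (x, y)) t = 0)" by simp
  \<comment> \<open>Finitely many witnesses have a common bound, so the unbounded search moves in
    front of the bounded quantifier.\<close>
  have bound: "(\<forall>y<n. \<exists>t. f (prod_encode (x, y)) t = 0) \<longleftrightarrow>
      (\<exists>T. \<forall>y<n. \<exists>t<T. f (prod_encode (x, y)) t = 0)" for x n
  proof (induction n)
    case (Suc n)
    show ?case
    proof
      assume L: "\<forall>y<Suc n. \<exists>t. f (prod_encode (x, y)) t = 0"
      then have "\<forall>y<n. \<exists>t. f (prod_encode (x, y)) t = 0" by simp
      then obtain T where T: "\<forall>y<n. \<exists>t<T. f (prod_encode (x, y)) t = 0"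
        unfolding Suc by blast
      from L obtain t where "f (prod_encode (x, n)) t = 0" by blast
      then have "\<exists>t'<T + Suc t. f (prod_encode (x, y)) t' = 0" if "y < Suc n" for y
      proof (cases "y = n")
        case True
        then show ?thesis using \<open>f (prod_encode (x, n)) t = 0\<close> by (intro exI[of _ t]) simp
      next
        case False
        with that T obtain t' where "t' < T" "f (prod_encode (x, y)) t' = 0"
          by (auto simp: less_Suc_eq)
        then show ?thesis by (intro exI[of _ t']) simp
      qed
      then show "\<exists>T. \<forall>y<Suc n. \<exists>t<T. f (prod_encode (x, y)) t = 0" by blast
    qed blast
  qed simp
  \<comment> \<open>The product over \<open>t<T\<close> vanishes iff some witness lies below
    \<open>T\<close>; the sum over \<open>y\<close> vanishes iff this holds for every
    \<open>y\<close>.\<close>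
  show ?thesis
    by (rule semidecI[where f = "\<lambda>x T. \<Sum>y<b x. \<Prod>t<T. f (prod_encode (x, y)) t"])
      (intro computable_comp2[OF f] computable_intros computable_sum computable_prod computable_comp[OF b],
        simp add: P bound Ball_def Bex_def)
qed

lemma semidec_less:
  assumes f: "computable_fun f" and g: "computable_fun g"
  shows "semidec (\<lambda>x. f x < g x)"
  unfolding less_iff_Suc_add
  by (intro semidec_ex semidec_eq computable_comp[OF f] computable_comp[OF g] computable_intros)

lemmas semidec_intros = semidec_eq semidec_less semidec_conj semidec_disj semidec_ex semidec_ball

section \<open>Semidecidable predicates as c.e. sets, and the s-m-n theorem\<close>

lemma semidec_imp_ce:
  assumes "semidec P"
  shows "\<exists>p. \<forall>x. P x \<longleftrightarrow> (\<exists>y. runs p x y)"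
proof -
  obtain f' where f': "computable_fun2 f'" and "\<And>x. P x \<longleftrightarrow> (\<exists>t. f' x t = 0)"
    using assms unfolding semidec_def by blast
  moreover define f where "f = (\<lambda>z. f' (fst (prod_decode z)) (snd (prod_decode z)))"
  ultimately have f: "computable_fun f" and P: "\<And>x. P x \<longleftrightarrow> (\<exists>t. f (prod_encode (x, t)) = 0)"
    by (simp_all add: computable_fun2_def)
  from f obtain p where p: "\<And>x. runs p x (f x)" unfolding computable_fun_iff by blast
  \<comment> \<open>The program \<open>p\<close> is total, so the search \<open>PMin p\<close> halts
    exactly when a zero exists.\<close>
  have "P x \<longleftrightarrow> (\<exists>y. runs (PMin p) x y)" for x
  proof
    assume "P x"
    then have ex: "\<exists>t. f (prod_encode (x, t)) = 0" by (simp add: P)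
    let ?t = "LEAST t. f (prod_encode (x, t)) = 0"
    have "runs p (prod_encode (x, ?t)) 0" using p LeastI_ex[OF ex] by metis
    moreover have "\<exists>y. runs p (prod_encode (x, m)) (Suc y)" if "m < ?t" for m
      using not_less_Least[OF that] p by (metis not0_implies_Suc)
    ultimately show "\<exists>y. runs (PMin p) x y" using runs_min by blast
  next
    assume "\<exists>y. runs (PMin p) x y"
    then obtain y where "runs (PMin p) x y" by blast
    then have "runs p (prod_encode (x, y)) 0" by cases auto
    then show "P x" using p runs_deterministic P by metis
  qed
  then show ?thesis by blast
qed

lemma smn:
  assumes "semidec (\<lambda>z. R (fst (prod_decode z)) (snd (prod_decode z)))"
  shows "\<exists>h. computable_fun h \<and> (\<forall>e. ce_set (h e) = {x. R e x})"
proof -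
  obtain p where "\<And>z. R (fst (prod_decode z)) (snd (prod_decode z)) \<longleftrightarrow> (\<exists>y. runs p z y)"
    using semidec_imp_ce[OF assms] by blast
  from this[of "prod_encode (_, _)"]
  have p: "\<And>e x. R e x \<longleftrightarrow> (\<exists>y. runs p (prod_encode (e, x)) y)" by simp
  \<comment> \<open>The program \<open>q e\<close> forms the pair of the hard-coded \<open>e\<close>
    and its input, then runs \<open>p\<close>.\<close>
  define q where "q e = PComp p (PPair (const_prog e) (PPair PFst PSnd))" for e
  \<comment> \<open>Each successor in \<open>const_prog\<close> is a \<open>PComp\<close> (tag 5)
    with \<open>PSucc\<close> (code 1), so the code is given by primitive recursion.\<close>
  have eq: "goedel (const_prog e) = rec_nat 0 (\<lambda>_ r. 5 + 4 * prod_encode (1, r)) e" for e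
    by (induction e) auto
  have "computable_fun (\<lambda>e. goedel (q e))"
    unfolding q_def goedel.simps eq
    by (intro computable_intros computable_rec)
  moreover have "ce_set (goedel (q e)) = {x. R e x}" for e
  proof -
    have "(\<exists>y. runs (q e) x y) \<longleftrightarrow> R e x" for x
    proof
      assume "\<exists>y. runs (q e) x y"
      then obtain y w where "runs (PPair (const_prog e) (PPair PFst PSnd)) x w" "runs p w y"
        unfolding q_def by (auto elim: runs.cases)
      moreover have "runs (PPair (const_prog e) (PPair PFst PSnd)) x (prod_encode (e, x))"
        by (intro runs_pair runs_const runs_id)
      ultimately show "R e x" using runs_deterministic p by metis
    next
      assume "R e x"
      then show "\<exists>y. runs (q e) x y"
        unfolding q_def p by (meson runs_comp runs_const runs_id runs_pair)
    qed
    then show ?thesis by (simp add: ce_set_def phi_goedel)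
  qed
  ultimately show ?thesis by blast
qed


section \<open>Finite certificates for computations of the universal function\<close>

text \<open>
  One evaluation step of \<^const>\<open>runs\<close>, on Goedel numbers, relative to a set \<open>F\<close> of known results.
  A finite set of results closed under justification certifies each of its members.
\<close>

inductive justified :: "(nat \<Rightarrow> nat \<Rightarrow> nat \<Rightarrow> bool) \<Rightarrow> nat \<Rightarrow> nat \<Rightarrow> nat \<Rightarrow> bool" for F where
  zero: "justified F 0 x 0"
| succ: "justified F (Suc 0) x (Suc x)"
| fst: "justified F 2 (prod_encode (x, y)) x"
| snd: "justified F 3 (prod_encode (x, y)) y"
| pair: "F f x y \<Longrightarrow> F g x z \<Longrightarrow> justified F (4 + 4 * prod_encode (f, g)) x (prod_encode (y, z))"
| comp: "F g x y \<Longrightarrow> F f y z \<Longrightarrow> justified F (5 + 4 * prod_encode (f, g)) x z"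
| rec_0: "F f a y \<Longrightarrow> justified F (6 + 4 * prod_encode (f, g)) (prod_encode (a, 0)) y"
| rec_Suc: "F (6 + 4 * prod_encode (f, g)) (prod_encode (a, n)) y \<Longrightarrow>
    F g (prod_encode (a, prod_encode (n, y))) z \<Longrightarrow>
    justified F (6 + 4 * prod_encode (f, g)) (prod_encode (a, Suc n)) z"
| min: "F f (prod_encode (a, n)) 0 \<Longrightarrow> \<forall>m<n. \<exists>y. F f (prod_encode (a, m)) (Suc y) \<Longrightarrow>
    justified F (7 + 4 * f) a n"

text \<open>\<open>F\<close> occurs only positively in the rules. Hence certificates may be united
  and enlarged.\<close>

lemma justified_mono:
  assumes "justified F e x y" "\<And>e x y. F e x y \<Longrightarrow> G e x y"
  shows "justified G e x y"
  using assms(1)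
proof cases
  case (min f)
  then show ?thesis using assms(2) justified.min by metis
qed (use assms(2) in \<open>auto intro: justified.intros\<close>)

text \<open>
  No well-foundedness of \<open>F\<close> is needed: every premise of a justification concerns a smaller
  program, or the same program with a smaller recursion argument.
\<close>

lemma justified_sound:
  assumes F: "\<And>e x y. F e x y \<Longrightarrow> justified F e x y"
  shows "F e x y \<Longrightarrow> phi e x y"
proof (induction "(e, snd (prod_decode x))" arbitrary: e x y
    rule: wf_induct_rule[OF wf_lex_prod[OF wf_less_than wf_less_than]])
  case (1 e x y)
  have IH: "phi f x' y'" if "F f x' y'" "f < e \<or> f = e \<and> snd (prod_decode x') < snd (prod_decode x)"
    for f x' y' using 1(1)[of f x' y'] that by simp
  have le: "f \<le> prod_encode (f, g)" "g \<le> prod_encode (f, g)" for f g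
    by (rule le_prod_encode_1 le_prod_encode_2)+
  from F[OF 1(2)] show ?case
  proof cases
    case zero
    then show ?thesis using runs_zero phi_goedel[of PZero] by simp
  next
    case succ
    then show ?thesis using runs_succ phi_goedel[of PSucc] by simp
  next
    case fst
    then show ?thesis using runs_fst phi_goedel[of PFst] by simp
  next
    case snd
    then show ?thesis using runs_snd phi_goedel[of PSnd] by simp
  next
    case (pair f u g v)
    have "f < e" "g < e" using le[of f g] le[of g f] pair(1) by linarith+
    with IH pair obtain p q where "goedel p = f" "goedel q = g" "runs p x u" "runs q x v"
      unfolding phi_def by metis
    then have "runs (PPair p q) x y" "goedel (PPair p q) = e" using pair runs_pair by auto
    then show ?thesis unfolding phi_def by blast
  next
    case (comp g u f)
    have "f < e" "g < e" using le[of f g] le[of g f] comp(1) by linarith+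
    with IH comp obtain p q where "goedel p = f" "goedel q = g" "runs q x u" "runs p u y"
      unfolding phi_def by metis
    then have "runs (PComp p q) x y" "goedel (PComp p q) = e" using comp runs_comp by auto
    then show ?thesis unfolding phi_def by blast
  next
    case (rec_0 f a g)
    have "f < e" using le[of f g] rec_0(1) by linarith
    with IH rec_0 obtain p where p: "goedel p = f" "runs p a y" unfolding phi_def by metis
    obtain q where "goedel q = g" using goedel_surj by blast
    with p have "runs (PRec p q) x y" "goedel (PRec p q) = e" using rec_0 runs_rec_0 by auto
    then show ?thesis unfolding phi_def by blast
  next
    case (rec_Suc f g a n u)
    have "g < e" using le[of g f] rec_Suc(1) by linarith
    then have "phi e (prod_encode (a, n)) u" "phi g (prod_encode (a, prod_encode (n, u))) y"
      using IH rec_Suc by auto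
    moreover obtain p q where "goedel p = f" "goedel q = g" using goedel_surj by metis
    moreover from this have pq: "goedel (PRec p q) = e" using rec_Suc by simp
    ultimately have "runs (PRec p q) x y"
      using phi_goedel runs_rec_Suc rec_Suc(2) by metis
    then show ?thesis unfolding phi_def using pq by blast
  next
    case (min f)
    have "f < e" using min by simp
    with IH min obtain p where p: "goedel p = f" "runs p (prod_encode (x, y)) 0"
      unfolding phi_def by metis
    have "\<exists>u. runs p (prod_encode (x, m)) (Suc u)" if "m < y" for m
      using IH min(3) that \<open>f < e\<close> p(1) phi_goedel by metis
    then have "runs (PMin p) x y" using p(2) by (intro runs_min)
    moreover have "goedel (PMin p) = e" using p min by simp
    ultimately show ?thesis unfolding phi_def by blast
  qed
qed

text \<open>Results are coded as numbers, so that a finite certificate is itself coded by one number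
  through \<open>set_decode\<close>.\<close>

definition certificate :: "nat set \<Rightarrow> bool" where
  "certificate C \<longleftrightarrow> (\<forall>e x y. prod_encode (e, prod_encode (x, y)) \<in> C \<longrightarrow>
     justified (\<lambda>e x y. prod_encode (e, prod_encode (x, y)) \<in> C) e x y)"

lemma certificate_UN:
  assumes "\<And>i. i \<in> I \<Longrightarrow> certificate (C i)"
  shows "certificate (\<Union>i\<in>I. C i)"
  unfolding certificate_def
proof (intro allI impI)
  fix e x y assume "prod_encode (e, prod_encode (x, y)) \<in> (\<Union>i\<in>I. C i)"
  then obtain i where i: "i \<in> I" "prod_encode (e, prod_encode (x, y)) \<in> C i" by blast
  with assms have "justified (\<lambda>e x y. prod_encode (e, prod_encode (x, y)) \<in> C i) e x y"
    unfolding certificate_def by blast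
  then show "justified (\<lambda>e x y. prod_encode (e, prod_encode (x, y)) \<in> (\<Union>i\<in>I. C i)) e x y"
    by (rule justified_mono) (use i in blast)
qed

lemma certificate_Un: "certificate C \<Longrightarrow> certificate D \<Longrightarrow> certificate (C \<union> D)"
  using certificate_UN[of UNIV "\<lambda>b. if b then C else D"] by (simp add: UNIV_bool Un_commute)

lemma certificate_insert:
  assumes C: "certificate C"
    and j: "justified (\<lambda>e x y. prod_encode (e, prod_encode (x, y)) \<in> C) e x y"
  shows "certificate (insert (prod_encode (e, prod_encode (x, y))) C)"
  unfolding certificate_def
proof (intro allI impI)
  fix e' x' y'
  assume "prod_encode (e', prod_encode (x', y')) \<in> insert (prod_encode (e, prod_encode (x, y))) C"
  then have "justified (\<lambda>e x y. prod_encode (e, prod_encode (x, y)) \<in> C) e' x' y'"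
    using j C unfolding certificate_def by auto
  then show "justified (\<lambda>e' x' y'. prod_encode (e', prod_encode (x', y')) \<in>
      insert (prod_encode (e, prod_encode (x, y))) C) e' x' y'"
    by (rule justified_mono) blast
qed

lemma finite_certificate:
  assumes "finite C" "certificate C"
    and "justified (\<lambda>e x y. prod_encode (e, prod_encode (x, y)) \<in> C) e x y"
  shows "\<exists>C. finite C \<and> certificate C \<and> prod_encode (e, prod_encode (x, y)) \<in> C"
  using certificate_insert[OF assms(2,3)] assms(1)
  by (intro exI[of _ "insert (prod_encode (e, prod_encode (x, y))) C"]) simp

text \<open>By induction on the run: unite the certificates of the premises and add the conclusion,
  which they justify.\<close>

lemma runs_certificate:
  "runs p x y \<Longrightarrow> \<exists>C. finite C \<and> certificate C \<and> prod_encode (goedel p, prod_encode (x, y)) \<in> C"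
proof (induction rule: runs.induct)
  case (runs_zero x)
  show ?case
    by (rule finite_certificate[of "{}"]) (simp_all add: certificate_def justified.zero)
next
  case (runs_succ x)
  show ?case
    by (rule finite_certificate[of "{}"]) (simp_all add: certificate_def justified.succ)
next
  case (runs_fst x y)
  show ?case
    by (rule finite_certificate[of "{}"]) (simp_all add: certificate_def justified.fst)
next
  case (runs_snd x y)
  show ?case
    by (rule finite_certificate[of "{}"]) (simp_all add: certificate_def justified.snd)
next
  case (runs_pair f x y g z)
  then obtain C D where "finite C" "certificate C" "prod_encode (goedel f, prod_encode (x, y)) \<in> C"
    and "finite D" "certificate D" "prod_encode (goedel g, prod_encode (x, z)) \<in> D" by blast
  then show ?case
    by (intro finite_certificate[of "C \<union> D"]) (simp_all add: certificate_Un justified.pair)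
next
  case (runs_comp g x y f z)
  then obtain C D where "finite C" "certificate C" "prod_encode (goedel g, prod_encode (x, y)) \<in> C"
    and "finite D" "certificate D" "prod_encode (goedel f, prod_encode (y, z)) \<in> D" by blast
  then show ?case unfolding goedel.simps
    by (intro finite_certificate[of "C \<union> D"] justified.comp[of _ "goedel g" x y])
      (simp_all add: certificate_Un)
next
  case (runs_rec_0 f a y g)
  then obtain C where "finite C" "certificate C" "prod_encode (goedel f, prod_encode (a, y)) \<in> C"
    by blast
  then show ?case
    by (intro finite_certificate[of C]) (simp_all add: justified.rec_0)
next
  case (runs_rec_Suc f g a n y z)
  then obtain C D where "finite C" "certificate C"
      "prod_encode (goedel (PRec f g), prod_encode (prod_encode (a, n), y)) \<in> C"
    and "finite D" "certificate D"
      "prod_encode (goedel g, prod_encode (prod_encode (a, prod_encode (n, y)), z)) \<in> D" by blast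
  then show ?case unfolding goedel.simps
    by (intro finite_certificate[of "C \<union> D"] justified.rec_Suc[of _ "goedel f" "goedel g" a n y])
      (simp_all add: certificate_Un)
next
  case (runs_min f a n)
  obtain C where C: "finite C" "certificate C"
      "prod_encode (goedel f, prod_encode (prod_encode (a, n), 0)) \<in> C"
    using runs_min.IH(1) by blast
  \<comment> \<open>Minimisation has one premise for each \<open>m < n\<close>; a certificate is
    chosen for each, and their union stays finite.\<close>
  have "\<forall>m. \<exists>D. m < n \<longrightarrow> finite D \<and> certificate D \<and>
      (\<exists>y. prod_encode (goedel f, prod_encode (prod_encode (a, m), Suc y)) \<in> D)"
    using runs_min.IH(2) by metis
  then obtain D where D: "\<And>m. m < n \<Longrightarrow> finite (D m) \<and> certificate (D m) \<and>
      (\<exists>y. prod_encode (goedel f, prod_encode (prod_encode (a, m), Suc y)) \<in> D m)"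
    by metis
  let ?E = "C \<union> (\<Union>m\<in>{..<n}. D m)"
  have E: "finite ?E" "certificate ?E"
    using C D by (auto intro!: certificate_Un certificate_UN)
  have "\<exists>y. prod_encode (goedel f, prod_encode (prod_encode (a, m), Suc y)) \<in> ?E" if "m < n" for m
    using D[OF that] that by blast
  then show ?case unfolding goedel.simps
    using C by (intro finite_certificate[OF E] justified.min allI impI) blast+
qed

text \<open>Halting becomes a search over a single number whose correctness is checked by bounded
  quantifiers and arithmetic.\<close>

lemma phi_iff_certificate:
  "phi e x y \<longleftrightarrow> (\<exists>c. certificate (set_decode c) \<and> prod_encode (e, prod_encode (x, y)) \<in> set_decode c)"
proof
  assume "phi e x y"
  then obtain C where "finite C" "certificate C" "prod_encode (e, prod_encode (x, y)) \<in> C"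
    using runs_certificate unfolding phi_def by blast
  then show "\<exists>c. certificate (set_decode c) \<and> prod_encode (e, prod_encode (x, y)) \<in> set_decode c"
    by (metis set_encode_inverse)
next
  assume "\<exists>c. certificate (set_decode c) \<and> prod_encode (e, prod_encode (x, y)) \<in> set_decode c"
  then obtain c where c: "certificate (set_decode c)"
    "prod_encode (e, prod_encode (x, y)) \<in> set_decode c" by blast
  show "phi e x y"
    by (rule justified_sound[where F = "\<lambda>e x y. prod_encode (e, prod_encode (x, y)) \<in> set_decode c"])
      (use c in \<open>auto simp: certificate_def\<close>)
qed

section \<open>Semidecidability of the graph of the universal function\<close>

lemma semidec_mem_set_decode:
  assumes z: "computable_fun z" and c: "computable_fun c"
  shows "semidec (\<lambda>x. z x \<in> set_decode (c x))" "semidec (\<lambda>x. z x \<notin> set_decode (c x))"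
proof -
  \<comment> \<open>A binary digit of \<open>c\<close> is described by guessing the quotient and
    remainder, which leaves only addition, multiplication and powers to compute.\<close>
  have digit: "(\<exists>q r. r < 2 ^ z \<and> c = (2 * q + i) * 2 ^ z + r) \<longleftrightarrow> c div 2 ^ z mod 2 = i"
    if "i < 2" for c z i :: nat
  proof
    assume "\<exists>q r. r < 2 ^ z \<and> c = (2 * q + i) * 2 ^ z + r"
    then obtain q r where "r < 2 ^ z" "c = (2 * q + i) * 2 ^ z + r" by blast
    then have "c div 2 ^ z = 2 * q + i" by simp
    then show "c div 2 ^ z mod 2 = i" using that by simp
  next
    assume "c div 2 ^ z mod 2 = i"
    then have "2 * (c div 2 ^ z div 2) + i = c div 2 ^ z"
      by (metis mult_div_mod_eq)
    then have "c = (2 * (c div 2 ^ z div 2) + i) * 2 ^ z + c mod 2 ^ z"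
      by (metis div_mult_mod_eq)
    then show "\<exists>q r. r < 2 ^ z \<and> c = (2 * q + i) * 2 ^ z + r"
      by (metis mod_less_divisor pos2 zero_less_power)
  qed
  have "z \<in> set_decode c \<longleftrightarrow> c div 2 ^ z mod 2 = 1" "z \<notin> set_decode c \<longleftrightarrow> c div 2 ^ z mod 2 = 0"
    for z c by (auto simp: set_decode_def odd_iff_mod_2_eq_one even_iff_mod_2_eq_zero)
  then have mem: "z \<in> set_decode c \<longleftrightarrow> (\<exists>q r. r < 2 ^ z \<and> c = (2 * q + 1) * 2 ^ z + r)"
    and nmem: "z \<notin> set_decode c \<longleftrightarrow> (\<exists>q r. r < 2 ^ z \<and> c = (2 * q + 0) * 2 ^ z + r)" for z c
    using digit[of 1 z c] digit[of 0 z c] by simp_all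
  show "semidec (\<lambda>x. z x \<in> set_decode (c x))"
    unfolding mem by (intro semidec_intros computable_intros computable_comp[OF z] computable_comp[OF c])
  show "semidec (\<lambda>x. z x \<notin> set_decode (c x))"
    unfolding nmem by (intro semidec_intros computable_intros computable_comp[OF z] computable_comp[OF c])
qed

text \<open>A set bit at \<open>z\<close> forces 2 to the power \<open>z\<close> to be at most
  \<open>c\<close>. This bounds the quantifier over the members of a certificate.\<close>

lemma mem_set_decode_less: "z \<in> set_decode c \<Longrightarrow> z < c"
proof (rule ccontr)
  assume "z \<in> set_decode c" "\<not> z < c"
  then have "c < 2 ^ z" using less_exp[of z] by linarith
  then show False using \<open>z \<in> set_decode c\<close> by (simp add: set_decode_def)
qed

lemma semidec_certificate: "semidec (\<lambda>c. certificate (set_decode c))"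
proof -
  \<comment> \<open>The implication becomes a disjunction with non-membership, which is
    semidecidable too. Unfolding \<open>justified.simps\<close> then leaves only semidecidable atoms
    under closure operations already available.\<close>
  have iff: "certificate (set_decode c) \<longleftrightarrow> (\<forall>z<c. z \<notin> set_decode c \<or>
      justified (\<lambda>e x y. prod_encode (e, prod_encode (x, y)) \<in> set_decode c)
        (fst (prod_decode z)) (fst (prod_decode (snd (prod_decode z))))
        (snd (prod_decode (snd (prod_decode z)))))" for c
    unfolding certificate_def
    by (metis mem_set_decode_less prod.sel prod_decode_inverse prod_encode_inverse prod.collapse)
  show ?thesis
    unfolding iff justified.simps
    by (intro semidec_intros semidec_mem_set_decode computable_intros)
qed

lemma semidec_phi:
  assumes "computable_fun e" "computable_fun x" "computable_fun y"
  shows "semidec (\<lambda>z. phi (e z) (x z) (y z))"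
  unfolding phi_iff_certificate
  by (intro semidec_intros semidec_mem_set_decode semidec_comp[OF semidec_certificate]
      computable_intros computable_comp[OF assms(1)] computable_comp[OF assms(2)]
      computable_comp[OF assms(3)])

lemma semidec_ce_set:
  assumes "computable_fun e" "computable_fun x"
  shows "semidec (\<lambda>z. x z \<in> ce_set (e z))"
  unfolding ce_set_def mem_Collect_eq
  by (intro semidec_intros semidec_phi computable_intros computable_comp[OF assms(1)]
      computable_comp[OF assms(2)])


section \<open>Computable metric spaces and the effective Borel hierarchy\<close>

lemma pos_rat_enum_encode: "pos_rat_enum (prod_encode (a, b)) = (real a + 1) / (real b + 1)"
  by (simp add: pos_rat_enum_def)

lemma pos_rat_enum_pos: "pos_rat_enum j > 0"
  by (auto simp: pos_rat_enum_def split: prod.split)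

lemma pos_rat_enum_dense:
  assumes "0 \<le> a" "a < b"
  obtains j where "a < pos_rat_enum j" "pos_rat_enum j < b"
proof -
  obtain r where r: "r \<in> \<rat>" "a < r" "r < b" using Rats_dense_in_real[OF assms(2)] by blast
  then obtain m n :: nat where mn: "n \<noteq> 0" "\<bar>r\<bar> = real m / real n"
    using Rats_abs_nat_div_natE by metis
  then have "m \<noteq> 0" using r assms(1) by (intro notI) simp
  \<comment> \<open>The enumeration adds 1 to the numerator and the denominator, hence the
    predecessors.\<close>
  with mn obtain m' n' where "m = Suc m'" "n = Suc n'" by (metis not0_implies_Suc)
  then have "pos_rat_enum (prod_encode (m', n')) = r"
    using mn r assms(1) by (simp add: pos_rat_enum_encode add.commute)
  then show thesis using r that by metis
qed

lemma semidec_pos_rat_less: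
  assumes f: "computable_fun f" and g: "computable_fun g"
  shows "semidec (\<lambda>z. pos_rat_enum (f z) < pos_rat_enum (g z))"
proof -
  \<comment> \<open>Cross-multiplication reduces the comparison to natural numbers.\<close>
  have iff: "pos_rat_enum i < pos_rat_enum j \<longleftrightarrow>
      Suc (fst (prod_decode i)) * Suc (snd (prod_decode j)) <
      Suc (fst (prod_decode j)) * Suc (snd (prod_decode i))" for i j
  proof -
    have "pos_rat_enum i < pos_rat_enum j \<longleftrightarrow>
        real (Suc (fst (prod_decode i)) * Suc (snd (prod_decode j))) <
        real (Suc (fst (prod_decode j)) * Suc (snd (prod_decode i)))"
      by (simp add: pos_rat_enum_def case_prod_beta divide_simps algebra_simps)
    then show ?thesis unfolding of_nat_less_iff .
  qed
  show ?thesis unfolding iff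
    by (intro semidec_less computable_intros computable_comp[OF f] computable_comp[OF g])
qed

lemma semidec_pos_rat_sum_less:
  assumes "computable_fun f" "computable_fun g" "computable_fun h" "computable_fun k"
  shows "semidec (\<lambda>z. pos_rat_enum (f z) + pos_rat_enum (g z) + pos_rat_enum (h z) < rat_enum (k z))"
proof -
  \<comment> \<open>The subtrahend \<open>v\<close> moves to the other side, so that after clearing
    denominators no truncated subtraction occurs.\<close>
  have frac: "a / b + c / d + e / f < (u - v) / w \<longleftrightarrow>
      (a * d * f + c * b * f + e * b * d) * w + v * (b * d * f) < u * (b * d * f)"
    if "b > 0" "d > 0" "f > 0" "w > 0" for a b c d e f u v w :: real
    using that by (simp add: field_simps)
  define num where "num j = Suc (fst (prod_decode j))" for j
  define den where "den j = Suc (snd (prod_decode j))" for j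
  define u where "u n = fst (prod_decode n)" for n
  define v where "v n = fst (prod_decode (snd (prod_decode n)))" for n
  define w where "w n = Suc (snd (prod_decode (snd (prod_decode n))))" for n
  have iff: "pos_rat_enum i + pos_rat_enum j + pos_rat_enum l < rat_enum n \<longleftrightarrow>
      (num i * den j * den l + num j * den i * den l + num l * den i * den j) * w n +
      v n * (den i * den j * den l) < u n * (den i * den j * den l)" for i j l n
  proof -
    have p: "pos_rat_enum j = real (num j) / real (den j)" for j
      by (simp add: pos_rat_enum_def num_def den_def case_prod_beta add.commute)
    have r: "rat_enum n = (real (u n) - real (v n)) / real (w n)"
      by (simp add: rat_enum_def u_def v_def w_def case_prod_beta add.commute)
    have pos: "0 < real (den j)" "0 < real (w n)" for j n by (simp_all add: den_def w_def)
    show ?thesis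
      unfolding p r frac[OF pos(1) pos(1) pos(1) pos(2)] of_nat_mult[symmetric]
        of_nat_add[symmetric] of_nat_less_iff ..
  qed
  show ?thesis unfolding iff unfolding num_def den_def u_def v_def w_def
    by (intro semidec_less computable_intros assms[THEN computable_comp])
qed

text \<open>A strict lower bound on a computable real is confirmed by some approximation that
  exceeds the bound by more than its error.\<close>

lemma semidec_center_dist:
  assumes s: "computable_metric_space s"
    and f: "computable_fun f" and g: "computable_fun g" and i: "computable_fun i" and j: "computable_fun j"
  shows "semidec (\<lambda>z. pos_rat_enum (f z) + pos_rat_enum (g z) < dist (s (i z)) (s (j z)))"
proof -
  obtain F where F: "computable_fun F" and idx: "\<And>i j. computable_real_index (F (prod_encode (i, j))) (dist (s i) (s j))"
  proof -
    from s obtain F where "computable_fun F" and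
      "\<And>m. computable_real_index (F m) (case prod_decode m of (i, j) \<Rightarrow> dist (s i) (s j))"
      unfolding computable_metric_space_def uniformly_def by blast
    from this(1) this(2)[of "prod_encode (_, _)"] show thesis by (intro that[of F]) simp_all
  qed
  have iff: "pos_rat_enum a + pos_rat_enum b < dist (s i) (s j) \<longleftrightarrow>
      (\<exists>k n. phi (F (prod_encode (i, j))) k n \<and>
        pos_rat_enum a + pos_rat_enum b + pos_rat_enum (prod_encode (0, k)) < rat_enum n)"
    (is "?L \<longleftrightarrow> ?R") for a b i j
  proof -
    \<comment> \<open>The error bound is relaxed to \<open>1 / (k + 1)\<close>, which is a member of
      the enumeration with a computable index.\<close>
    have prec: "1 / 2 ^ k \<le> pos_rat_enum (prod_encode (0, k))" for k
    proof -
      have "real k + 1 \<le> 2 ^ k" using less_exp[of k]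
        by (metis Suc_leI of_nat_Suc of_nat_le_iff of_nat_numeral of_nat_power add.commute)
      then show ?thesis by (simp add: pos_rat_enum_encode frac_le)
    qed
    have approx: "\<exists>n. phi (F (prod_encode (i, j))) k n \<and> \<bar>rat_enum n - dist (s i) (s j)\<bar> \<le> 1 / 2 ^ k" for k
      using idx unfolding computable_real_index_def by blast
    show ?thesis
    proof
      assume ?L
      \<comment> \<open>Half the gap is taken because the margin is spent twice: once for the error
        of the approximation and once in the test.\<close>
      then have "0 < (dist (s i) (s j) - (pos_rat_enum a + pos_rat_enum b)) / 2" by simp
      then obtain k where "inverse (real (Suc k)) <
          (dist (s i) (s j) - (pos_rat_enum a + pos_rat_enum b)) / 2"
        using reals_Archimedean by blast
      then have k: "pos_rat_enum (prod_encode (0, k)) <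
          (dist (s i) (s j) - (pos_rat_enum a + pos_rat_enum b)) / 2"
        by (simp add: pos_rat_enum_encode inverse_eq_divide add.commute)
      obtain n where n: "phi (F (prod_encode (i, j))) k n" "\<bar>rat_enum n - dist (s i) (s j)\<bar> \<le> 1 / 2 ^ k"
        using approx by blast
      have "q < r" if "p < (d - q') / 2" "\<bar>r - d\<bar> \<le> t" "t \<le> p" "q = q' + p" for p q q' r d t :: real
      proof -
        have "2 * p < d - q'" using that(1) by (simp add: field_simps)
        moreover have "d - t \<le> r" using abs_le_D2[OF that(2)] by simp
        ultimately show ?thesis using that(3,4) by linarith
      qed
      from this[OF k n(2) prec refl]
      have "pos_rat_enum a + pos_rat_enum b + pos_rat_enum (prod_encode (0, k)) < rat_enum n" .
      with n(1) show ?R by blast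
    next
      assume ?R
      then obtain k n where kn: "phi (F (prod_encode (i, j))) k n"
        "pos_rat_enum a + pos_rat_enum b + pos_rat_enum (prod_encode (0, k)) < rat_enum n" by blast
      \<comment> \<open>By determinism, the \<open>n\<close> found by the search is the
        approximation that the index guarantees.\<close>
      then have "\<bar>rat_enum n - dist (s i) (s j)\<bar> \<le> 1 / 2 ^ k"
        using approx phi_deterministic by metis
      then show ?L using kn(2) prec[of k] by linarith
    qed
  qed
  show ?thesis unfolding iff
    by (intro semidec_intros semidec_phi semidec_pos_rat_sum_less computable_intros
        computable_comp[OF F] computable_comp[OF f] computable_comp[OF g] computable_comp[OF i]
        computable_comp[OF j])
qed

section \<open>Closed balls and the inclusions between levels of the hierarchy\<close>

lemma ideal_ball_encode: "ideal_ball s (prod_encode (i, j)) = ball (s i) (pos_rat_enum j)"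
  by (simp add: ideal_ball_def)

text \<open>The ideal balls enumerated have a centre farther away than the sum of both radii, which
  is semidecidable. They miss the closed ball by the triangle inequality, and by density they cover
  its complement.\<close>

lemma compl_cball_index:
  assumes s: "computable_metric_space s"
  shows "\<exists>c. computable_fun c \<and>
    (\<forall>i j. Sigma_set s (Suc 0) (c (prod_encode (i, j))) = - cball (s i) (pos_rat_enum j))"
proof -
  define R where "R m l \<longleftrightarrow> pos_rat_enum (snd (prod_decode m)) + pos_rat_enum (snd (prod_decode l)) <
    dist (s (fst (prod_decode m))) (s (fst (prod_decode l)))" for m l
  have "semidec (\<lambda>z. R (fst (prod_decode z)) (snd (prod_decode z)))"
    unfolding R_def by (intro semidec_center_dist s computable_intros)
  then have "\<exists>c. computable_fun c \<and> (\<forall>m. ce_set (c m) = {l. R m l})"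
    by (rule smn)
  then obtain c where c: "computable_fun c" "\<And>m. ce_set (c m) = {l. R m l}" by blast
  have "Sigma_set s (Suc 0) (c (prod_encode (i, j))) = - cball (s i) (pos_rat_enum j)" for i j
  proof (intro set_eqI iffI)
    fix y assume "y \<in> Sigma_set s (Suc 0) (c (prod_encode (i, j)))"
    then obtain l where "R (prod_encode (i, j)) l" "y \<in> ideal_ball s l" by (auto simp: c)
    then have "pos_rat_enum j + pos_rat_enum (snd (prod_decode l)) < dist (s i) (s (fst (prod_decode l)))"
      "dist (s (fst (prod_decode l))) y < pos_rat_enum (snd (prod_decode l))"
      by (simp_all add: R_def ideal_ball_def case_prod_beta)
    then show "y \<in> - cball (s i) (pos_rat_enum j)"
      using dist_triangle[of "s i" "s (fst (prod_decode l))" y]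
      by (simp add: dist_commute)
  next
    fix y assume "y \<in> - cball (s i) (pos_rat_enum j)"
    \<comment> \<open>Half the gap again: replacing \<open>y\<close> by a nearby centre costs one
      radius, and the test demands another.\<close>
    then have "0 < (dist (s i) y - pos_rat_enum j) / 2" by simp
    then obtain b where b: "pos_rat_enum b < (dist (s i) y - pos_rat_enum j) / 2"
      using pos_rat_enum_dense by blast
    have "y \<in> closure (range s)" using s by (simp add: computable_metric_space_def)
    then obtain a where a: "dist (s a) y < pos_rat_enum b"
      using closure_approachable pos_rat_enum_pos by blast
    then have "pos_rat_enum j + pos_rat_enum b < dist (s i) (s a)"
      using b dist_triangle[of "s i" y "s a"] by (simp add: dist_commute)
    then have "R (prod_encode (i, j)) (prod_encode (a, b))" by (simp add: R_def)
    moreover have "y \<in> ideal_ball s (prod_encode (a, b))" using a by (simp add: ideal_ball_encode)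
    ultimately show "y \<in> Sigma_set s (Suc 0) (c (prod_encode (i, j)))" by (auto simp: c)
  qed
  then show ?thesis using c(1) by blast
qed

text \<open>This lifts an index transformation by one level, since an index at the next level
  denotes a c.e. set of indices at the present one.\<close>

lemma image_index:
  assumes f: "computable_fun f"
  shows "\<exists>h. computable_fun h \<and> (\<forall>e. ce_set (h e) = f ` ce_set e)"
proof -
  have "semidec (\<lambda>z. \<exists>i. i \<in> ce_set (fst (prod_decode z)) \<and> snd (prod_decode z) = f i)"
    by (intro semidec_intros semidec_ce_set computable_intros computable_comp[OF f])
  then have "\<exists>h. computable_fun h \<and> (\<forall>e. ce_set (h e) = {x. \<exists>i. i \<in> ce_set e \<and> x = f i})"
    by (rule smn)
  then obtain h where "computable_fun h" "\<And>e. ce_set (h e) = {x. \<exists>i. i \<in> ce_set e \<and> x = f i}" by blast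
  then show ?thesis by (intro exI[of _ h]) auto
qed

text \<open>Complements of these closed balls are uniformly \<open>\<Sigma>\<^sup>0\<^sub>1\<close>,
  so this exhibits an ideal ball as a \<open>\<Sigma>\<^sup>0\<^sub>2\<close> set.\<close>

lemma ball_eq_UN_cball:
  "ball x (pos_rat_enum j) = (\<Union>l\<in>{l. pos_rat_enum l < pos_rat_enum j}. cball x (pos_rat_enum l))"
proof (intro set_eqI iffI)
  fix y assume "y \<in> ball x (pos_rat_enum j)"
  then obtain l where "dist x y < pos_rat_enum l" "pos_rat_enum l < pos_rat_enum j"
    using pos_rat_enum_dense[of "dist x y" "pos_rat_enum j"] by auto
  then show "y \<in> (\<Union>l\<in>{l. pos_rat_enum l < pos_rat_enum j}. cball x (pos_rat_enum l))"
    by (auto intro!: exI[of _ l])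
qed auto

text \<open>Level 1 goes into level 2 by exhausting open balls by closed ones; higher levels follow
  by mapping the index function over the c.e. set. Computability of \<open>g\<close> is what carries
  the induction.\<close>

lemma Sigma_set_subset_Suc:
  assumes s: "computable_metric_space s"
  shows "\<exists>g. computable_fun g \<and> (\<forall>e. Sigma_set s (Suc (Suc n)) (g e) = Sigma_set s (Suc n) e)"
proof (induction n)
  case 0
  obtain c where c: "computable_fun c"
    "\<And>i j. Sigma_set s (Suc 0) (c (prod_encode (i, j))) = - cball (s i) (pos_rat_enum j)"
    using compl_cball_index[OF s] by blast
  have "semidec (\<lambda>z. \<exists>i j l. prod_encode (i, j) \<in> ce_set (fst (prod_decode z)) \<and>
      pos_rat_enum l < pos_rat_enum j \<and> snd (prod_decode z) = c (prod_encode (i, l)))"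
    by (intro semidec_intros semidec_ce_set semidec_pos_rat_less computable_intros computable_comp[OF c(1)])
  then have "\<exists>g. computable_fun g \<and> (\<forall>e. ce_set (g e) = {m. \<exists>i j l. prod_encode (i, j) \<in> ce_set e \<and>
      pos_rat_enum l < pos_rat_enum j \<and> m = c (prod_encode (i, l))})"
    by (rule smn)
  then obtain g where g: "computable_fun g" "\<And>e. ce_set (g e) = {m. \<exists>i j l. prod_encode (i, j) \<in> ce_set e \<and>
      pos_rat_enum l < pos_rat_enum j \<and> m = c (prod_encode (i, l))}" by blast
  have "Sigma_set s (Suc (Suc 0)) (g e) = Sigma_set s (Suc 0) e" for e
  proof -
    have "Sigma_set s (Suc (Suc 0)) (g e) = (\<Union>m\<in>ce_set (g e). - Sigma_set s (Suc 0) m)"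
      by (rule Sigma_set.simps)
    also have "\<dots> = (\<Union>(i, j)\<in>{(i, j). prod_encode (i, j) \<in> ce_set e}.
        \<Union>l\<in>{l. pos_rat_enum l < pos_rat_enum j}. - Sigma_set s (Suc 0) (c (prod_encode (i, l))))"
      unfolding g(2) by blast
    also have "\<dots> = (\<Union>(i, j)\<in>{(i, j). prod_encode (i, j) \<in> ce_set e}. ball (s i) (pos_rat_enum j))"
      unfolding c(2) ball_eq_UN_cball by simp
    also have "\<dots> = (\<Union>m\<in>ce_set e. ideal_ball s m)"
      unfolding ideal_ball_encode[symmetric] by (auto, metis prod_decode_inverse prod.collapse)
    finally show ?thesis by simp
  qed
  then show ?case using g(1) by blast
next
  case (Suc n)
  then obtain g where g: "computable_fun g" "\<And>e. Sigma_set s (Suc (Suc n)) (g e) = Sigma_set s (Suc n) e"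
    by blast
  obtain h where h: "computable_fun h" "\<And>e. ce_set (h e) = g ` ce_set e"
    using image_index[OF g(1)] by blast
  have "Sigma_set s (Suc (Suc (Suc n))) (h e) = Sigma_set s (Suc (Suc n)) e" for e
  proof -
    have "Sigma_set s (Suc (Suc (Suc n))) (h e) = (\<Union>i\<in>ce_set e. - Sigma_set s (Suc (Suc n)) (g i))"
      by (subst Sigma_set.simps) (simp only: h(2) image_image)
    then show ?thesis unfolding g(2) by simp
  qed
  then show ?case using h(1) by blast
qed

text \<open>At each level the set is a union over \<open>ce_set e\<close> of sets depending only on
  the level, so a union of c.e. index sets yields the union of the sets they denote.\<close>

lemma Sigma_set_UN:
  assumes "ce_set e = (\<Union>i\<in>I. ce_set (f i))"
  shows "Sigma_set s (Suc n) e = (\<Union>i\<in>I. Sigma_set s (Suc n) (f i))"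
  using assms by (cases n) auto

lemma Sigma_set_borel: "Sigma_set s n e \<in> sets borel"
proof (induction s n e rule: Sigma_set.induct)
  case (2 s e)
  show ?case by (auto simp: ideal_ball_def split: prod.split)
next
  case (3 s n e)
  then show ?case
    by (subst Sigma_set.simps) (intro sets.countable_UN'' borel_comp; simp)
qed simp


section \<open>Preimages under a computable transformation\<close>

text \<open>Preimages commute with unions, and with complements relative to \<open>dom T\<close>, so
  a computable index function passes from each level to the next.\<close>

lemma pre_image_Sigma:
  assumes T: "computable_transformation s T"
  shows "\<exists>h. computable_fun h \<and>
    (\<forall>e. pre_image T (Sigma_set s (Suc n) e) = dom T \<inter> Sigma_set s (Suc n) (h e))"
proof (induction n)
  case 0
  obtain f where f: "computable_fun f"
    "\<And>i. pre_image T (ideal_ball s i) = dom T \<inter> Sigma_set s (Suc 0) (f i)"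
    using T unfolding computable_transformation_def uniformly_def Sigma_in_index_def One_nat_def
    by blast
  have "semidec (\<lambda>z. \<exists>i. i \<in> ce_set (fst (prod_decode z)) \<and> snd (prod_decode z) \<in> ce_set (f i))"
    by (intro semidec_intros semidec_ce_set computable_intros computable_comp[OF f(1)])
  then have "\<exists>h. computable_fun h \<and> (\<forall>e. ce_set (h e) = {j. \<exists>i. i \<in> ce_set e \<and> j \<in> ce_set (f i)})"
    by (rule smn)
  then obtain h where h: "computable_fun h" "\<And>e. ce_set (h e) = {j. \<exists>i. i \<in> ce_set e \<and> j \<in> ce_set (f i)}" by blast
  have "pre_image T (Sigma_set s (Suc 0) e) = dom T \<inter> Sigma_set s (Suc 0) (h e)" for e
  proof -
    have "pre_image T (Sigma_set s (Suc 0) e) = (\<Union>i\<in>ce_set e. pre_image T (ideal_ball s i))"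
      by (auto simp: pre_image_def)
    also have "\<dots> = dom T \<inter> (\<Union>i\<in>ce_set e. Sigma_set s (Suc 0) (f i))"
      unfolding f(2) by blast
    also have "\<dots> = dom T \<inter> Sigma_set s (Suc 0) (h e)"
      by (subst Sigma_set_UN[where I = "ce_set e" and f = f]) (auto simp: h(2))
    finally show ?thesis .
  qed
  then show ?case using h(1) by blast
next
  case (Suc n)
  then obtain g where g: "computable_fun g"
    "\<And>e. pre_image T (Sigma_set s (Suc n) e) = dom T \<inter> Sigma_set s (Suc n) (g e)" by blast
  obtain h where h: "computable_fun h" "\<And>e. ce_set (h e) = g ` ce_set e"
    using image_index[OF g(1)] by blast
  have compl: "pre_image T (- B) = dom T - pre_image T B" for B
    by (auto simp: pre_image_def)
  have "pre_image T (Sigma_set s (Suc (Suc n)) e) = dom T \<inter> Sigma_set s (Suc (Suc n)) (h e)" for e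
  proof -
    have "pre_image T (Sigma_set s (Suc (Suc n)) e) = (\<Union>i\<in>ce_set e. pre_image T (- Sigma_set s (Suc n) i))"
      by (subst Sigma_set.simps) (auto simp: pre_image_def)
    also have "\<dots> = dom T \<inter> (\<Union>i\<in>g ` ce_set e. - Sigma_set s (Suc n) i)"
      unfolding compl g(2) by blast
    finally show ?thesis by (subst (2) Sigma_set.simps) (simp only: h(2))
  qed
  then show ?case using h(1) by blast
qed

text \<open>With the extra \<open>T\<close> applied first, the preimage under the longer iterate is
  the \<open>T\<close>-preimage of the earlier one.\<close>

lemma iterate_Suc': "iterate T (Suc k) = iterate T k \<circ>\<^sub>m T"
proof (induction k)
  case (Suc k)
  have "iterate T (Suc (Suc k)) = T \<circ>\<^sub>m (iterate T k \<circ>\<^sub>m T)" using Suc by simp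
  also have "\<dots> = iterate T (Suc k) \<circ>\<^sub>m T" by (auto simp: map_comp_def split: option.splits)
  finally show ?case .
qed (auto simp: map_comp_def split: option.splits)

lemma pre_image_comp: "pre_image (F \<circ>\<^sub>m G) B = pre_image G (pre_image F B)"
  by (auto simp: pre_image_def map_comp_def split: option.splits)

text \<open>Since \<open>T\<close> maps its domain into itself, the factor \<open>dom T\<close> does
  not accumulate when preimages are iterated.\<close>

lemma pre_image_dom_Int:
  assumes "\<And>x y. T x = Some y \<Longrightarrow> y \<in> dom T"
  shows "pre_image T (dom T \<inter> B) = pre_image T B"
  using assms by (auto simp: pre_image_def)

text \<open>The count starts at \<open>Suc k\<close>, as \<open>iterate T 0\<close> is the total map
  \<open>Some\<close>, whose preimages are not cut down to \<open>dom T\<close>.\<close>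

lemma pre_image_iterate_Sigma:
  assumes dom: "\<And>x y. T x = Some y \<Longrightarrow> y \<in> dom T"
    and h: "\<And>e. pre_image T (Sigma_set s n e) = dom T \<inter> Sigma_set s n (h e)"
  shows "pre_image (iterate T (Suc k)) (Sigma_set s n e) = dom T \<inter> Sigma_set s n ((h ^^ Suc k) e)"
proof (induction k)
  case 0
  have "T \<circ>\<^sub>m Some = T" by (auto simp: map_comp_def)
  then show ?case by (simp add: h)
next
  case (Suc k)
  show ?case
    by (simp only: iterate_Suc'[of T "Suc k"] pre_image_comp Suc pre_image_dom_Int[OF dom])
      (simp add: h)
qed

section \<open>Poincare recurrence for partial measure-preserving maps\<close>

text \<open>
  With \<open>E\<close> the set of points of \<open>dom T\<close> that visit \<open>A\<close> at some time \<open>k \<ge> 0\<close>, the preimage of \<open>E\<close>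
  is a subset of \<open>E\<close> of the same measure.
\<close>

lemma poincare_recurrence:
  assumes "prob_space \<mu>" "space \<mu> = UNIV" and T: "measure_preserving \<mu> T" and A: "A \<in> sets \<mu>"
  shows "dom T \<inter> A - (\<Union>k. pre_image (iterate T (Suc k)) A) \<in> null_sets \<mu>"
proof -
  interpret prob_space \<mu> by fact
  have pre: "pre_image T B \<in> sets \<mu>" "emeasure \<mu> (pre_image T B) = emeasure \<mu> B" if "B \<in> sets \<mu>" for B
    using T that unfolding measure_preserving_def by blast+
  have "pre_image T UNIV = dom T" by (auto simp: pre_image_def)
  then have dom: "dom T \<in> sets \<mu>" using pre(1)[of UNIV] sets.top[of \<mu>] assms(2) by simp
  have iter: "pre_image (iterate T k) A \<in> sets \<mu>" for k
  proof (induction k)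
    case 0
    then show ?case using A by (simp add: pre_image_def)
  next
    case (Suc k)
    then show ?case unfolding iterate_Suc' pre_image_comp by (rule pre(1))
  qed
  define E where "E = dom T \<inter> (\<Union>k. pre_image (iterate T k) A)"
  have E: "E \<in> sets \<mu>" unfolding E_def using dom iter by auto
  \<comment> \<open>Taking the preimage of \<open>E\<close> shifts all visiting times by one, so it
    consists of the points that visit \<open>A\<close> at a positive time.\<close>
  have U: "pre_image T E = dom T \<inter> (\<Union>k. pre_image (iterate T (Suc k)) A)"
  proof -
    have "pre_image T E = pre_image T (\<Union>k. pre_image (iterate T k) A)"
      unfolding E_def
      by (rule pre_image_dom_Int) (use T in \<open>auto simp: measure_preserving_def\<close>)
    also have "\<dots> = (\<Union>k. pre_image (iterate T (Suc k)) A)"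
      unfolding iterate_Suc' pre_image_comp by (auto simp: pre_image_def)
    also have "\<dots> = dom T \<inter> (\<Union>k. pre_image (iterate T (Suc k)) A)"
      unfolding iterate_Suc' pre_image_comp by (auto simp: pre_image_def)
    finally show ?thesis .
  qed
  then have "pre_image T E \<subseteq> E" unfolding E_def by blast
  \<comment> \<open>Invariance gives both sets the same finite measure, so the difference is
    null.\<close>
  then have "emeasure \<mu> (E - pre_image T E) = 0"
    using pre[OF E] E by (subst emeasure_Diff) auto
  then have "E - pre_image T E \<in> null_sets \<mu>" using pre[OF E] E by auto
  moreover have "dom T \<inter> A - (\<Union>k. pre_image (iterate T (Suc k)) A) \<in> sets \<mu>"
    using dom iter[of "Suc _"] A by (intro sets.Diff sets.Int sets.countable_UN) auto
  \<comment> \<open>A point of \<open>dom T\<close> in \<open>A\<close> visits \<open>A\<close> at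
    time 0 and so lies in \<open>E\<close>.\<close>
  moreover have "dom T \<inter> A - (\<Union>k. pre_image (iterate T (Suc k)) A) \<subseteq> E - pre_image T E"
  proof -
    have "A \<subseteq> (\<Union>k. pre_image (iterate T k) A)"
    proof
      fix y assume "y \<in> A"
      then have "y \<in> pre_image (iterate T 0) A" by (simp add: pre_image_def)
      then show "y \<in> (\<Union>k. pre_image (iterate T k) A)" by blast
    qed
    then have "dom T \<inter> A \<subseteq> E" unfolding E_def by (rule Int_mono[OF subset_refl])
    then show ?thesis unfolding U by (rule Diff_mono) (rule Int_lower2)
  qed
  ultimately show ?thesis by (rule null_sets_subset)
qed

theorem theorem2p1:
  fixes s :: "nat \<Rightarrow> 'a::polish_space"
    and \<mu> :: "'a measure"
    and n :: nat
    and x :: 'a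
    and A :: "'a set"
    and T :: "'a \<rightharpoonup> 'a"
  assumes "computable_probability_space s \<mu>"
    and "n \<ge> 1"
    and "weakly_random s \<mu> n x"
    and "is_Sigma s n A"
    and "x \<in> A"
    and "emeasure \<mu> A > 0"
    and "measure_preserving \<mu> T"
    and "computable_transformation s T"
    and "x \<in> dom T"
  shows "\<exists>k>0. \<exists>y\<in>A. iterate T k x = Some y"
proof (rule ccontr)
  assume never: "\<not> ?thesis"
  have s: "computable_metric_space s" and sets: "sets \<mu> = sets borel" and prob: "prob_space \<mu>"
    using assms(1) by (auto simp: computable_probability_space_def)
  interpret prob_space \<mu> by fact
  have space: "space \<mu> = UNIV" using sets_eq_imp_space_eq[OF sets] by simp
  obtain m where n: "n = Suc m" using assms(2) by (cases n) auto
  obtain e where A: "A = Sigma_set s (Suc m) e" using assms(4) by (auto simp: is_Sigma_def n)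
  have meas: "Sigma_set s l i \<in> sets \<mu>" for l i by (simp add: sets Sigma_set_borel)
  obtain g where "\<And>e. Sigma_set s (Suc (Suc m)) (g e) = Sigma_set s (Suc m) e"
    using Sigma_set_subset_Suc[OF s] by blast
  then have "A = (\<Union>i\<in>ce_set (g e). - Sigma_set s (Suc m) i)" by (simp add: A)
  then obtain i where i: "x \<in> - Sigma_set s (Suc m) i" "- Sigma_set s (Suc m) i \<subseteq> A"
    using assms(5) by blast
  obtain h where h: "computable_fun h"
    "\<And>e. pre_image T (Sigma_set s (Suc m) e) = dom T \<inter> Sigma_set s (Suc m) (h e)"
    using pre_image_Sigma[OF assms(8)] by blast
  have dom: "T z = Some y \<Longrightarrow> y \<in> dom T" for z y
    using assms(7) by (auto simp: measure_preserving_def)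
  have iter: "pre_image (iterate T (Suc k)) A = dom T \<inter> Sigma_set s (Suc m) ((h ^^ Suc k) e)" for k
    unfolding A by (rule pre_image_iterate_Sigma[OF dom h(2)])
  \<comment> \<open>The sequence of indices starts with \<open>i\<close> and continues with those of
    the preimages for positive times. The recursor serves as a case distinction, which makes
    \<open>computable_rec\<close> applicable.\<close>
  define f where "f k = rec_nat i (\<lambda>l _. (h ^^ Suc l) e) k" for k
  have pow: "rec_nat e (\<lambda>_ r. h r) k = (h ^^ k) e" for k by (induction k) auto
  have "computable_fun (\<lambda>k. rec_nat e (\<lambda>_ r. h r) k)"
    by (intro computable_rec computable_intros computable_comp[OF h(1)])
  then have "computable_fun (\<lambda>k. (h ^^ k) e)" by (simp add: pow)
  then have f: "computable_fun f"
    unfolding f_def by (intro computable_rec computable_intros) (rule computable_comp, assumption, intro computable_intros)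
  \<comment> \<open>The s-m-n theorem is applied with a dummy parameter; its value at 0 indexes the
    union of all these sets.\<close>
  have "semidec (\<lambda>z. \<exists>k. snd (prod_decode z) \<in> ce_set (f k))"
    by (intro semidec_intros semidec_ce_set computable_intros computable_comp[OF f])
  then have "\<exists>q. computable_fun q \<and> (\<forall>e. ce_set (q e) = {x. \<exists>k. x \<in> ce_set (f k)})"
    by (rule smn)
  then obtain q :: "nat \<Rightarrow> nat" where "\<And>e. ce_set (q e) = {x. \<exists>k. x \<in> ce_set (f k)}" by blast
  then have "ce_set (q 0) = (\<Union>k. ce_set (f k))" by auto
  then have "Sigma_set s (Suc m) (q 0) = (\<Union>k. Sigma_set s (Suc m) (f k))" by (rule Sigma_set_UN)
  also have "\<dots> = Sigma_set s (Suc m) i \<union> (\<Union>k. Sigma_set s (Suc m) ((h ^^ Suc k) e))"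
  proof -
    have "range f = insert i (range (\<lambda>k. (h ^^ Suc k) e))"
      unfolding f_def by (auto simp: image_iff split: nat.splits) (metis nat.exhaust old.nat.simps(6,7))+
    then have "(\<Union>j\<in>range f. Sigma_set s (Suc m) j) =
        (\<Union>j\<in>insert i (range (\<lambda>k. (h ^^ Suc k) e)). Sigma_set s (Suc m) j)" by (rule arg_cong)
    then show ?thesis by (simp add: image_image)
  qed
  finally have q: "Sigma_set s (Suc m) (q 0) =
    Sigma_set s (Suc m) i \<union> (\<Union>k. Sigma_set s (Suc m) ((h ^^ Suc k) e))" .
  let ?P = "- Sigma_set s (Suc m) (q 0)"
  have "is_Pi s n ?P" unfolding is_Pi_def is_Sigma_def n by auto
  moreover have "?P \<in> null_sets \<mu>"
  proof -
    \<comment> \<open>As the preimage of the whole space, \<open>dom T\<close> has measure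
      1.\<close>
    have UNIV: "pre_image T UNIV = dom T" by (auto simp: pre_image_def)
    have top: "UNIV \<in> sets \<mu>" using sets.top[of \<mu>] by (simp add: space)
    then have dom_meas: "dom T \<in> sets \<mu>" "emeasure \<mu> (dom T) = 1"
      using assms(7) emeasure_space_1 unfolding measure_preserving_def UNIV[symmetric] by (auto simp: space)
    then have "- dom T \<in> null_sets \<mu>"
      using emeasure_compl[of "dom T" \<mu>] emeasure_space_1
      by (auto simp: null_sets_def space Compl_eq_Diff_UNIV top)
    moreover have "dom T \<inter> A - (\<Union>k. pre_image (iterate T (Suc k)) A) \<in> null_sets \<mu>"
      by (rule poincare_recurrence) (use prob space assms(7) meas A in auto)
    ultimately have "- dom T \<union> (dom T \<inter> A - (\<Union>k. pre_image (iterate T (Suc k)) A)) \<in> null_sets \<mu>"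
      by (rule null_sets.Un)
    moreover have "?P \<in> sets \<mu>" unfolding sets by (intro borel_comp Sigma_set_borel)
    \<comment> \<open>The indices describe the preimages only inside \<open>dom T\<close>, so the
      null set \<open>- dom T\<close> is added to the non-recurrent points.\<close>
    moreover have "?P \<subseteq> - dom T \<union> (dom T \<inter> A - (\<Union>k. pre_image (iterate T (Suc k)) A))"
      using i(2) unfolding q iter by blast
    ultimately show ?thesis by (rule null_sets_subset)
  qed
  ultimately have "x \<notin> ?P" using assms(3) unfolding weakly_random_def by blast
  then obtain k where "x \<in> Sigma_set s (Suc m) ((h ^^ Suc k) e)" using i(1) unfolding q by blast
  then have "x \<in> pre_image (iterate T (Suc k)) A" using assms(9) unfolding iter by blast
  then show False using never unfolding pre_image_def by blast
qed

end
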